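(* Let $h,g\in \ell^{2}(\mathbb{Z})$. If the infinitely iterated dyadic filter bank generated by $h$ and $g$ is stable with bounds $0<A\le B<\infty$, then for every $j\in\mathbb{N}$ the finitely iterated dyadic filter bank of order $j$ generated by $h$ and $g$ is stable with bounds $\min\{A, A/B\}$ and $\max\{B, B/A\}$; that is, for all $x\in\ell^2(\mathbb{Z})$ and all $j\in\mathbb{N}$, $$\min\{A,A/B\}\,\|x\|^2\le \sum_{l=1}^{j+1}\|(F_jx)_l\|^2\le \max\{B,B/A\}\,\|x\|^2 .$$
   Context: $\mathbb{N}=\{1,2,\dots\}$. For $x,y\in\ell^2(\mathbb{Z})$: $\langle x,y\rangle=\sum_m x(m)\overline{y(m)}$; convolution $(x*y)(k)=\sum_{n} y(n)x(k-n)$; involution $\overline{x}(k)=\overline{x(-k)}$; downsampling $Dx(n)=x(2n)$; upsampling $Ux(2m)=x(m)$, $Ux(n)=0$ for $n$ odd; translation $Tx(k)=x(k-1)$. Given filters $h,g$, the iterated filters of order $j\in\mathbb{N}$ are $h_j=h*Uh*\cdots*U^{j-1}h$ and $g_j=h_{j-1}*U^{j-1}g$ (with $g_1=g$, i.e. $h_0=\delta_0$). Infinitely iterated dyadic filter bank: the analysis operator $F:\ell^2(\mathbb{Z})\to\bigoplus_{j=1}^\infty\ell^2(\mathbb{Z})$, $Fx=\{(Fx)_j\}_{j\ge1}$, has components $(Fx)_j=D^j(x*\overline{g_j})$, i.e. $(Fx)_j(k)=\langle x,T^{2^jk}g_j\rangle$. It is stable with bounds $0<A\le B<\infty$ if $A\|x\|^2\le\sum_{j=1}^\infty\|(Fx)_j\|^2\le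 B\|x\|^2$ for all $x\in\ell^2(\mathbb{Z})$, equivalently if $\{T^{2^jk}g_j: j\in\mathbb{N},k\in\mathbb{Z}\}$ is a frame for $\ell^2(\mathbb{Z})$ with bounds $A,B$. Finitely iterated dyadic filter bank of order $j$: the analysis operator $F_j:\ell^2(\mathbb{Z})\to\bigoplus_{l=1}^{j+1}\ell^2(\mathbb{Z})$ has components $(F_jx)_l=D^l(x*\overline{g_l})$ for $1\le l\le j$ and $(F_jx)_{j+1}=D^j(x*\overline{h_j})$, i.e. $(F_jx)_{j+1}(k)=\langle x,T^{2^jk}h_j\rangle$. It is stable with bounds $0<A'\le B'<\infty$ if $A'\|x\|^2\le\sum_{l=1}^{j+1}\|(F_jx)_l\|^2\le B'\|x\|^2$ for all $x\in\ell^2(\mathbb{Z})$. *)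

theory Defs
  imports "HOL-Analysis.Analysis"
begin

type_synonym seq = "int \<Rightarrow> complex"

definition l2 :: "seq \<Rightarrow> bool" where
  "l2 x \<longleftrightarrow> (\<lambda>m. (cmod (x m))\<^sup>2) summable_on UNIV"

definition l2_norm :: "seq \<Rightarrow> real" where
  "l2_norm x = sqrt (\<Sum>\<^sub>\<infinity>m. (cmod (x m))\<^sup>2)"

definition delta0 :: seq where
  "delta0 k = (if k = 0 then 1 else 0)"

definition conv :: "seq \<Rightarrow> seq \<Rightarrow> seq" where
  "conv x y k = (\<Sum>\<^sub>\<infinity>n. y n * x (k - n))"

definition invol :: "seq \<Rightarrow> seq" where
  "invol x k = cnj (x (- k))"

definition downsample :: "seq \<Rightarrow> seq" where
  "downsample x n = x (2 * n)"

definition upsample :: "seq \<Rightarrow> seq" where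
  "upsample x n = (if even n then x (n div 2) else 0)"

text \<open>
  The iterated filters are unparenthesised convolution products,
  h * U h * ... * U^(j-1) h  and  h * U h * ... * U^(j-2) h * U^(j-1) g.
  On square-summable sequences convolution is neither everywhere \<open>l2\<close>-valued nor
  associative without further assumptions, so a bracketing has to be fixed. The products are
  evaluated from the right: if every \<open>x \<mapsto> downsample^j (x * invol g_j)\<close> is bounded
  on square-summable sequences, then each sum occurring in the convolutions that define the
  filters \<open>gfilt h g j\<close> converges absolutely and each partial product is square-summable,
  with nothing assumed about h and g beyond square-summability. The lemma
  \<open>gfilt_eq_conv_hfilt\<close> below shows that this is h_(j-1) * U^(j-1) g in the
  standard case of absolutely summable h.
\<close>

definition hfilt :: "seq \<Rightarrow> nat \<Rightarrow> seq" where
  "hfilt h j = foldr conv (map (\<lambda>i. (upsample ^^ i) h) [0..<j]) delta0"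

definition gfilt :: "seq \<Rightarrow> seq \<Rightarrow> nat \<Rightarrow> seq" where
  "gfilt h g j =
     foldr conv (map (\<lambda>i. (upsample ^^ i) h) [0..<j - 1]) ((upsample ^^ (j - 1)) g)"

definition inf_analysis :: "seq \<Rightarrow> seq \<Rightarrow> seq \<Rightarrow> nat \<Rightarrow> seq" where
  "inf_analysis h g x j = (downsample ^^ j) (conv x (invol (gfilt h g j)))"

definition fin_analysis :: "seq \<Rightarrow> seq \<Rightarrow> nat \<Rightarrow> seq \<Rightarrow> nat \<Rightarrow> seq" where
  "fin_analysis h g j x l =
     (if l \<le> j then (downsample ^^ l) (conv x (invol (gfilt h g l)))
      else (downsample ^^ j) (conv x (invol (hfilt h j))))"

text \<open>
  Both notions of stability include that the analysis operator takes values in the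
  direct sum of copies of the space of square-summable sequences. Applied to the unit vectors
  at 0, ..., 2^j - 1 this yields that the filters involved are themselves square-summable.
\<close>

definition inf_stable :: "seq \<Rightarrow> seq \<Rightarrow> real \<Rightarrow> real \<Rightarrow> bool" where
  "inf_stable h g A B \<longleftrightarrow> 0 < A \<and> A \<le> B \<and>
     (\<forall>x. l2 x \<longrightarrow>
        (\<forall>j\<ge>1. l2 (inf_analysis h g x j)) \<and>
        (\<lambda>j. (l2_norm (inf_analysis h g x j))\<^sup>2) summable_on {1..} \<and>
        A * (l2_norm x)\<^sup>2 \<le> (\<Sum>\<^sub>\<infinity>j\<in>{1..}. (l2_norm (inf_analysis h g x j))\<^sup>2) \<and>
        (\<Sum>\<^sub>\<infinity>j\<in>{1..}. (l2_norm (inf_analysis h g x j))\<^sup>2) \<le> B * (l2_norm x)\<^sup>2)"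

definition fin_stable :: "seq \<Rightarrow> seq \<Rightarrow> nat \<Rightarrow> real \<Rightarrow> real \<Rightarrow> bool" where
  "fin_stable h g j A B \<longleftrightarrow> 0 < A \<and> A \<le> B \<and>
     (\<forall>x. l2 x \<longrightarrow>
        (\<forall>l\<in>{1..j + 1}. l2 (fin_analysis h g j x l)) \<and>
        A * (l2_norm x)\<^sup>2 \<le> (\<Sum>l = 1..j + 1. (l2_norm (fin_analysis h g j x l))\<^sup>2) \<and>
        (\<Sum>l = 1..j + 1. (l2_norm (fin_analysis h g j x l))\<^sup>2) \<le> B * (l2_norm x)\<^sup>2)"

definition l1 :: "seq \<Rightarrow> bool" where
  "l1 x \<longleftrightarrow> (\<lambda>m. cmod (x m)) summable_on UNIV"

lemma summable_prod_pair:
  assumes "l1 a" "l1 b"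
  shows "(\<lambda>(p, q). cmod (b p) * cmod (a q)) summable_on UNIV"
proof -
  have sa: "(\<lambda>m. cmod (a m)) summable_on UNIV" and sb: "(\<lambda>m. cmod (b m)) summable_on UNIV"
    using assms by (auto simp: l1_def)
  have "(\<lambda>(p, q). cmod (b p) * cmod (a q)) summable_on (UNIV \<times> UNIV)"
    by (rule summable_on_SigmaI[where g = "\<lambda>p. cmod (b p) * infsum (\<lambda>q. cmod (a q)) UNIV"])
      (auto intro!: has_sum_cmult_right summable_on_cmult_left has_sum_infsum sa sb)
  then show ?thesis by simp
qed

lemma l1_conv:
  assumes "l1 a" "l1 b"
  shows "l1 (conv a b)"
proof -
  have "bij_betw (\<lambda>(k, n). (n, k - n)) (UNIV :: (int \<times> int) set) UNIV"
    by (rule bij_betwI[where g = "\<lambda>(p, q). (p + q, p)"]) auto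
  from summable_on_reindex_bij_betw[OF this, of "\<lambda>(p, q). cmod (b p) * cmod (a q)"]
    summable_prod_pair[OF assms]
  have *: "(\<lambda>(k, n). cmod (b n * a (k - n))) summable_on UNIV \<times> UNIV"
    by (simp add: case_prod_unfold norm_mult)
  have row: "(\<lambda>n. cmod (b n * a (k - n))) summable_on UNIV" for k
    using summable_on_SigmaD1[OF *] by simp
  have "(\<lambda>k. \<Sum>\<^sub>\<infinity>n. cmod (b n * a (k - n))) summable_on UNIV"
    using summable_on_SigmaD[OF *] row by simp
  then show ?thesis
    unfolding l1_def
    by (rule summable_on_comparison_test) (auto simp: conv_def intro!: norm_infsum_bound row)
qed

lemma conv_assoc:
  assumes "l1 a" "l1 b" and c: "\<And>m. cmod (c m) \<le> M"
  shows "conv (conv a b) c = conv a (conv b c)"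
proof
  fix k
  have "bij_betw (\<lambda>(n, m). (n - m, k - n)) (UNIV :: (int \<times> int) set) UNIV"
    by (rule bij_betwI[where g = "\<lambda>(p, q). (k - q, k - q - p)"]) auto
  from summable_on_reindex_bij_betw[OF this, of "\<lambda>(p, q). cmod (b p) * cmod (a q)"]
    summable_prod_pair[OF assms(1,2)]
  have "(\<lambda>(n, m). cmod (b (n - m)) * cmod (a (k - n))) summable_on UNIV"
    by (simp add: case_prod_unfold)
  from summable_on_cmult_right[OF this, of M]
  have "(\<lambda>x. cmod (case x of (n, m) \<Rightarrow> c m * b (n - m) * a (k - n))) summable_on UNIV"
    by (rule summable_on_comparison_test)
      (auto simp: norm_mult mult.assoc intro!: mult_right_mono c)
  then have s: "(\<lambda>(n, m). c m * b (n - m) * a (k - n)) summable_on UNIV \<times> UNIV"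
    using abs_summable_summable by auto
  have "conv a (conv b c) k = (\<Sum>\<^sub>\<infinity>n. \<Sum>\<^sub>\<infinity>m. c m * b (n - m) * a (k - n))"
    unfolding conv_def by (simp add: infsum_cmult_left')
  also have "\<dots> = (\<Sum>\<^sub>\<infinity>m. \<Sum>\<^sub>\<infinity>n. c m * b (n - m) * a (k - n))"
    by (rule infsum_swap_banach) (use s in simp)
  also have "\<dots> = (\<Sum>\<^sub>\<infinity>m. c m * (\<Sum>\<^sub>\<infinity>n. b (n - m) * a (k - n)))"
    by (simp add: infsum_cmult_right' mult.assoc)
  also have "\<dots> = (\<Sum>\<^sub>\<infinity>m. c m * (\<Sum>\<^sub>\<infinity>n. b n * a (k - m - n)))"
  proof (rule infsum_cong)
    fix m :: int
    have "bij_betw (\<lambda>n. n - m) (UNIV :: int set) UNIV"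
      by (rule bij_betwI[where g = "\<lambda>n. n + m"]) auto
    from infsum_reindex_bij_betw[OF this, of "\<lambda>n. b n * a (k - m - n)"]
    show "c m * (\<Sum>\<^sub>\<infinity>n. b (n - m) * a (k - n)) = c m * (\<Sum>\<^sub>\<infinity>n. b n * a (k - m - n))"
      by (simp add: algebra_simps)
  qed
  finally show "conv (conv a b) c k = conv a (conv b c) k"
    by (simp add: conv_def)
qed

lemma conv_delta0_left: "conv delta0 x = x"
proof
  fix k
  have "conv delta0 x k = infsum (\<lambda>n. x n * delta0 (k - n)) {k}"
    unfolding conv_def by (rule infsum_cong_neutral) (auto simp: delta0_def)
  then show "conv delta0 x k = x k"
    by (simp add: delta0_def)
qed

lemma l1_delta0: "l1 delta0"
proof -
  have "(\<lambda>m. cmod (delta0 m)) summable_on {0}" by simp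
  then show ?thesis
    unfolding l1_def
    by (subst summable_on_cong_neutral[where T = "{0}" and g = "\<lambda>n. cmod (delta0 n)"])
      (auto simp: delta0_def)
qed

lemma foldr_conv:
  assumes "\<forall>x\<in>set xs. l1 x" and c: "\<And>m. cmod (c m) \<le> M"
  shows "l1 (foldr conv xs delta0) \<and> foldr conv xs c = conv (foldr conv xs delta0) c"
  using assms(1)
proof (induction xs)
  case Nil
  then show ?case by (simp add: l1_delta0 conv_delta0_left)
next
  case (Cons x xs)
  then show ?case by (auto simp: l1_conv conv_assoc[OF _ _ c])
qed

lemma l1_upsample:
  assumes "l1 x"
  shows "l1 (upsample x)"
proof -
  have "bij_betw (\<lambda>n. 2 * n) (UNIV :: int set) {n. even n}"
    by (rule bij_betwI[where g = "\<lambda>n. n div 2"]) auto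
  from summable_on_reindex_bij_betw[OF this, of "\<lambda>n. cmod (upsample x n)"] assms
  have "(\<lambda>n. cmod (upsample x n)) summable_on {n. even n}"
    by (simp add: l1_def upsample_def)
  then show ?thesis
    unfolding l1_def
    by (subst summable_on_cong_neutral[where T = "{n. even n}" and g = "\<lambda>n. cmod (upsample x n)"])
      (auto simp: upsample_def)
qed

lemma gfilt_eq_conv_hfilt:
  assumes "l1 h" "l2 g"
  shows "gfilt h g j = conv (hfilt h (j - 1)) ((upsample ^^ (j - 1)) g)"
proof -
  have "l1 ((upsample ^^ i) h)" for i
    by (induction i) (auto simp: assms l1_upsample)
  then have 1: "\<forall>x\<in>set (map (\<lambda>i. (upsample ^^ i) h) [0..<j - 1]). l1 x"
    by auto
  have g: "cmod (g m) \<le> l2_norm g" for m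
  proof -
    have "(cmod (g m))\<^sup>2 = infsum (\<lambda>m. (cmod (g m))\<^sup>2) {m}" by simp
    also have "\<dots> \<le> (\<Sum>\<^sub>\<infinity>m. (cmod (g m))\<^sup>2)"
      using assms(2) by (intro infsum_mono_neutral) (auto simp: l2_def)
    finally show ?thesis by (simp add: l2_norm_def real_le_rsqrt)
  qed
  have "0 \<le> l2_norm g"
    by (simp add: l2_norm_def infsum_nonneg)
  then have "cmod ((upsample ^^ i) g m) \<le> l2_norm g" for i m
    by (induction i arbitrary: m) (auto simp: g upsample_def)
  from foldr_conv[OF 1 this] show ?thesis
    by (simp add: gfilt_def hfilt_def)
qed

end

theory Submission
  imports Defs
begin

text \<open>
  The proof rests on one identity. Write \<open>H x\<close> for the output \<open>D (x * invol h)\<close> of the low-pass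
  branch (this is \<open>analysis h 1 x\<close> below). The filters satisfy \<open>h_(j+1) = h * U h_j\<close> and
  \<open>g_(m+1) = h * U g_m\<close>, and the synthesis map \<open>f \<mapsto> h * U f\<close> is the adjoint of \<open>H\<close>. Hence
  \<open>D^j (x * invol h_j) = H^j x\<close>, and feeding \<open>y = H^j x\<close> into the infinite filter bank returns
  exactly the tail of the analysis of \<open>x\<close>: \<open>(F x)_(m+j) = (F y)_m\<close> (lemma \<open>iterated_lowpass\<close>).
  Let \<open>s\<close> be the sum of the first \<open>j\<close> energies \<open>\<parallel>(F x)_l\<parallel>\<^sup>2\<close> and \<open>t\<close> the sum of the others. Then
  \<open>A \<parallel>x\<parallel>\<^sup>2 \<le> s + t \<le> B \<parallel>x\<parallel>\<^sup>2\<close>, and stability at \<open>y\<close> gives \<open>A \<parallel>y\<parallel>\<^sup>2 \<le> t \<le> B \<parallel>y\<parallel>\<^sup>2\<close>.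
  The energy of the finite filter bank is \<open>s + \<parallel>y\<parallel>\<^sup>2\<close>; comparing it with \<open>s + t\<close> costs at most a
  factor \<open>max 1 B\<close> from below and \<open>max 1 (1 / A)\<close> from above, which yields the bounds.

  The analytic difficulty is that \<open>h\<close> is only square-summable, so that neither the boundedness of
  \<open>H\<close> nor the adjointness relation, an interchange of two infinite sums, is available at the start.
  For \<open>x\<close> of finite support the interchange is one of a finite with an infinite sum, and \<open>H x\<close> is a
  finite combination of square-summable sequences. The identity for \<open>j = 1\<close> therefore holds for
  such \<open>x\<close> and gives \<open>A \<parallel>H x\<parallel>\<^sup>2 \<le> B \<parallel>x\<parallel>\<^sup>2\<close>, that is, stability itself bounds \<open>H\<close> on a dense
  subspace (lemma \<open>lowpass_bounded_of_inf_stable\<close>). A Fatou argument extends the bound to all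
  \<open>x\<close> (lemma \<open>lowpass_bound_from_cutoffs\<close>); duality shows that \<open>h * U f\<close> is square-summable
  (lemma \<open>l2_refine\<close>); and density extends the adjointness (lemma \<open>inner_refine\<close>).
\<close>

section \<open>Square-summable sequences\<close>

definition l2_inner :: "seq \<Rightarrow> seq \<Rightarrow> complex" where
  "l2_inner x y = (\<Sum>\<^sub>\<infinity>m. x m * cnj (y m))"

definition translate :: "int \<Rightarrow> seq \<Rightarrow> seq" where
  "translate k x m = x (m - k)"

definition cutoff :: "int set \<Rightarrow> seq \<Rightarrow> seq" where
  "cutoff S x m = (if m \<in> S then x m else 0)"

lemma l2_norm_nonneg: "0 \<le> l2_norm x"
  by (simp add: l2_norm_def infsum_nonneg)

lemma l2_norm_power2: "(l2_norm x)\<^sup>2 = (\<Sum>\<^sub>\<infinity>m. (cmod (x m))\<^sup>2)"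
  by (simp add: l2_norm_def infsum_nonneg)

lemma sum_power2_le_l2_norm:
  assumes "l2 x" "finite S"
  shows "(\<Sum>m\<in>S. (cmod (x m))\<^sup>2) \<le> (l2_norm x)\<^sup>2"
  unfolding l2_norm_power2 using assms by (intro finite_sum_le_infsum) (auto simp: l2_def)

lemma l2_boundedI:
  assumes "\<And>S. finite S \<Longrightarrow> (\<Sum>m\<in>S. (cmod (x m))\<^sup>2) \<le> c"
  shows "l2 x" and "(l2_norm x)\<^sup>2 \<le> c"
proof -
  show "l2 x"
    unfolding l2_def using assms
    by (intro nonneg_bdd_above_summable_on bdd_aboveI2[where M = c]) auto
  then show "(l2_norm x)\<^sup>2 \<le> c"
    unfolding l2_norm_power2 using assms by (intro infsum_le_finite_sums) (auto simp: l2_def)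
qed

lemma Cauchy_Schwarz_l2:
  assumes "l2 x" "l2 y"
  shows "(\<lambda>m. x m * cnj (y m)) summable_on UNIV"
    and "cmod (l2_inner x y) \<le> l2_norm x * l2_norm y"
proof -
  have fin: "(\<Sum>m\<in>S. cmod (x m * cnj (y m))) \<le> l2_norm x * l2_norm y" if "finite S" for S
  proof -
    have "(\<Sum>m\<in>S. cmod (x m * cnj (y m))) = (\<Sum>m\<in>S. \<bar>cmod (x m)\<bar> * \<bar>cmod (y m)\<bar>)"
      by (simp add: norm_mult)
    also have "\<dots> \<le> L2_set (\<lambda>m. cmod (x m)) S * L2_set (\<lambda>m. cmod (y m)) S"
      by (rule L2_set_mult_ineq)
    also have "\<dots> \<le> l2_norm x * l2_norm y"
      using sum_power2_le_l2_norm[OF assms(1) that] sum_power2_le_l2_norm[OF assms(2) that]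
      by (intro mult_mono) (auto simp: L2_set_def l2_norm_nonneg sum_nonneg intro: real_le_lsqrt)
    finally show ?thesis .
  qed
  have abs: "(\<lambda>m. cmod (x m * cnj (y m))) summable_on UNIV"
    using fin by (intro nonneg_bdd_above_summable_on bdd_aboveI2[where M = "l2_norm x * l2_norm y"]) auto
  then show "(\<lambda>m. x m * cnj (y m)) summable_on UNIV"
    by (rule abs_summable_summable)
  have "cmod (l2_inner x y) \<le> (\<Sum>\<^sub>\<infinity>m. cmod (x m * cnj (y m)))"
    unfolding l2_inner_def by (rule norm_infsum_bound[OF abs])
  also have "\<dots> \<le> l2_norm x * l2_norm y"
    using abs fin by (intro infsum_le_finite_sums) auto
  finally show "cmod (l2_inner x y) \<le> l2_norm x * l2_norm y" .
qed

lemma l2_translate: "l2 x \<Longrightarrow> l2 (translate k x)"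
proof -
  have "bij_betw (\<lambda>m. m - k) (UNIV :: int set) UNIV"
    by (rule bij_betwI[where g = "\<lambda>m. m + k"]) auto
  from summable_on_reindex_bij_betw[OF this, of "\<lambda>m. (cmod (x m))\<^sup>2"]
  show "l2 x \<Longrightarrow> l2 (translate k x)" by (simp add: l2_def translate_def)
qed

lemma l2_reflected_translate: "l2 x \<Longrightarrow> l2 (\<lambda>n. cnj (x (k - n)))"
proof -
  have "bij_betw (\<lambda>m. k - m) (UNIV :: int set) UNIV"
    by (rule bij_betwI[where g = "\<lambda>m. k - m"]) auto
  from summable_on_reindex_bij_betw[OF this, of "\<lambda>m. (cmod (x m))\<^sup>2"]
  show "l2 x \<Longrightarrow> l2 (\<lambda>n. cnj (x (k - n)))" by (simp add: l2_def)
qed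

lemma l2_subsequence:
  assumes "l2 x" "inj p"
  shows "l2 (\<lambda>n. x (p n))"
proof -
  have "(\<lambda>m. (cmod (x m))\<^sup>2) summable_on range p"
    using assms(1) unfolding l2_def by (rule summable_on_subset_banach) simp
  then show ?thesis
    using summable_on_reindex[OF assms(2), of "\<lambda>m. (cmod (x m))\<^sup>2"] by (simp add: l2_def o_def)
qed

lemma l2_cmult: "l2 x \<Longrightarrow> l2 (\<lambda>m. c * x m)"
  by (auto simp: l2_def norm_mult power_mult_distrib intro: summable_on_cmult_right)

lemma l2_add:
  assumes "l2 x" "l2 y"
  shows "l2 (\<lambda>m. x m + y m)"
proof -
  have "(\<lambda>m. 2 * (cmod (x m))\<^sup>2 + 2 * (cmod (y m))\<^sup>2) summable_on UNIV"
    using assms by (intro summable_on_add summable_on_cmult_right) (auto simp: l2_def)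
  moreover have "(cmod (x m + y m))\<^sup>2 \<le> 2 * (cmod (x m))\<^sup>2 + 2 * (cmod (y m))\<^sup>2" for m
  proof -
    have "(cmod (x m + y m))\<^sup>2 \<le> (cmod (x m) + cmod (y m))\<^sup>2"
      by (intro power_mono norm_triangle_ineq) simp
    also have "\<dots> \<le> 2 * (cmod (x m))\<^sup>2 + 2 * (cmod (y m))\<^sup>2"
      using sum_squares_bound[of "cmod (x m)" "cmod (y m)"] by (simp add: power2_sum)
    finally show ?thesis .
  qed
  ultimately show ?thesis
    unfolding l2_def by (rule summable_on_comparison_test) auto
qed

lemma l2_sum:
  assumes "finite S" "\<And>s. s \<in> S \<Longrightarrow> l2 (x s)"
  shows "l2 (\<lambda>m. \<Sum>s\<in>S. x s m)"
  using assms
proof (induction S)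
  case empty
  then show ?case by (simp add: l2_def)
next
  case (insert s S)
  then show ?case by (auto intro: l2_add)
qed

lemma l2_cutoff: "l2 x \<Longrightarrow> l2 (cutoff S x)"
  unfolding l2_def by (rule summable_on_comparison_test) (auto simp: cutoff_def)

lemma l2_norm_cutoff:
  assumes "finite S"
  shows "(l2_norm (cutoff S x))\<^sup>2 = (\<Sum>m\<in>S. (cmod (x m))\<^sup>2)"
proof -
  have "(l2_norm (cutoff S x))\<^sup>2 = (\<Sum>\<^sub>\<infinity>m\<in>S. (cmod (x m))\<^sup>2)"
    unfolding l2_norm_power2 by (rule infsum_cong_neutral) (auto simp: cutoff_def)
  with assms show ?thesis by simp
qed

lemma l2_inner_cutoff_left:
  assumes "finite S"
  shows "l2_inner (cutoff S x) y = (\<Sum>m\<in>S. x m * cnj (y m))"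
proof -
  have "l2_inner (cutoff S x) y = (\<Sum>\<^sub>\<infinity>m\<in>S. x m * cnj (y m))"
    unfolding l2_inner_def by (rule infsum_cong_neutral) (auto simp: cutoff_def)
  with assms show ?thesis by simp
qed

lemma cutoff_add_cutoff_Compl: "cutoff S x m + cutoff (- S) x m = x m"
  by (simp add: cutoff_def)

lemma l2_inner_add_left:
  assumes "l2 x" "l2 y" "l2 z"
  shows "l2_inner (\<lambda>m. x m + y m) z = l2_inner x z + l2_inner y z"
  unfolding l2_inner_def using Cauchy_Schwarz_l2(1)[OF assms(1,3)] Cauchy_Schwarz_l2(1)[OF assms(2,3)]
  by (simp add: distrib_right infsum_add)

text \<open>
  Sequences of finite support are dense. The limit is taken over the filter of finite index sets,
  which is the one that defines infinite sums, so that partial sums of an inner product are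
  inner products of cutoffs.
\<close>

lemma cutoff_Compl_tendsto_0:
  assumes "l2 x"
  shows "((\<lambda>S. l2_norm (cutoff (- S) x)) \<longlongrightarrow> 0) (finite_subsets_at_top UNIV)"
proof -
  have "((\<lambda>S. (l2_norm x)\<^sup>2 - (\<Sum>m\<in>S. (cmod (x m))\<^sup>2)) \<longlongrightarrow> 0)
      (finite_subsets_at_top UNIV)"
    using tendsto_diff[OF tendsto_const infsum_tendsto[OF assms[unfolded l2_def]], of "(l2_norm x)\<^sup>2"]
    by (simp add: l2_norm_power2)
  moreover have "\<forall>\<^sub>F S in finite_subsets_at_top UNIV.
      (l2_norm x)\<^sup>2 - (\<Sum>m\<in>S. (cmod (x m))\<^sup>2) = (l2_norm (cutoff (- S) x))\<^sup>2"
  proof (rule eventually_finite_subsets_at_top_weakI)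
    fix S :: "int set"
    assume "finite S"
    have s: "(\<lambda>m. (cmod (x m))\<^sup>2) summable_on - S"
      using assms unfolding l2_def by (rule summable_on_subset_banach) simp
    have "(l2_norm x)\<^sup>2 = (\<Sum>\<^sub>\<infinity>m\<in>S \<union> - S. (cmod (x m))\<^sup>2)"
      by (simp add: l2_norm_power2)
    also have "\<dots> = (\<Sum>m\<in>S. (cmod (x m))\<^sup>2) + (\<Sum>\<^sub>\<infinity>m\<in>- S. (cmod (x m))\<^sup>2)"
      using \<open>finite S\<close> by (subst infsum_Un_disjoint) (auto simp: s)
    also have "(\<Sum>\<^sub>\<infinity>m\<in>- S. (cmod (x m))\<^sup>2) = (l2_norm (cutoff (- S) x))\<^sup>2"
      unfolding l2_norm_power2 by (rule infsum_cong_neutral) (auto simp: cutoff_def)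
    finally show "(l2_norm x)\<^sup>2 - (\<Sum>m\<in>S. (cmod (x m))\<^sup>2) = (l2_norm (cutoff (- S) x))\<^sup>2"
      by simp
  qed
  ultimately have "((\<lambda>S. (l2_norm (cutoff (- S) x))\<^sup>2) \<longlongrightarrow> 0) (finite_subsets_at_top UNIV)"
    by (rule Lim_transform_eventually)
  then have "((\<lambda>S. sqrt ((l2_norm (cutoff (- S) x))\<^sup>2)) \<longlongrightarrow> sqrt 0) (finite_subsets_at_top UNIV)"
    by (rule tendsto_real_sqrt)
  then show ?thesis by (simp add: l2_norm_nonneg)
qed

lemma infsum_of_sum:
  fixes u :: "'a \<Rightarrow> 'b \<Rightarrow> complex"
  assumes "finite S" "\<And>s. s \<in> S \<Longrightarrow> u s summable_on A"
  shows "(\<Sum>\<^sub>\<infinity>n\<in>A. \<Sum>s\<in>S. u s n) = (\<Sum>s\<in>S. infsum (u s) A)"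
proof -
  have "((\<lambda>n. \<Sum>s\<in>S. u s n) has_sum (\<Sum>s\<in>S. infsum (u s) A)) A"
    using assms by (induction S) (auto intro!: has_sum_add)
  then show ?thesis by (rule infsumI)
qed

section \<open>Analysis and refinement\<close>

definition analysis :: "seq \<Rightarrow> nat \<Rightarrow> seq \<Rightarrow> seq" where
  "analysis f j x = (downsample ^^ j) (conv x (invol f))"

text \<open>
  The synthesis map of the low-pass branch: \<open>refine h f\<close> is the superposition
  \<open>\<Sum>n. f n * T\<^sup>2\<^sup>n h\<close>, see \<open>refine_eq\<close>.
\<close>

definition refine :: "seq \<Rightarrow> seq \<Rightarrow> seq" where
  "refine h f = conv h (upsample f)"

lemma downsample_funpow: "(downsample ^^ j) x k = x (2 ^ j * k)"
  by (induction j arbitrary: k) (auto simp: downsample_def mult_ac)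

text \<open>
  The substitution \<open>m = k - n\<close> is a bijection of the integers and preserves the infinite sum even
  when the terms are not summable; the same remark applies to the reindexings below, and this is
  why the identities for \<open>refine\<close> and \<open>upsample\<close> hold for arbitrary sequences.
\<close>

lemma conv_invol: "conv x (invol f) k = l2_inner x (translate k f)"
proof -
  have "bij_betw (\<lambda>n. k - n) (UNIV :: int set) UNIV"
    by (rule bij_betwI[where g = "\<lambda>n. k - n"]) auto
  from infsum_reindex_bij_betw[OF this, of "\<lambda>m. x m * cnj (f (m - k))"]
  show ?thesis by (simp add: conv_def invol_def l2_inner_def translate_def mult.commute)
qed

lemma analysis_eq_inner: "analysis f j x k = l2_inner x (translate (2 ^ j * k) f)"
  by (simp add: analysis_def downsample_funpow conv_invol)

lemma infsum_upsample_mult: "(\<Sum>\<^sub>\<infinity>n. upsample f n * u n) = (\<Sum>\<^sub>\<infinity>n. f n * u (2 * n))"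
proof -
  have "bij_betw (\<lambda>n. 2 * n) (UNIV :: int set) {n. even n}"
    by (rule bij_betwI[where g = "\<lambda>n. n div 2"]) auto
  from infsum_reindex_bij_betw[OF this, of "\<lambda>n. upsample f n * u n"]
  have "(\<Sum>\<^sub>\<infinity>n. f n * u (2 * n)) = (\<Sum>\<^sub>\<infinity>n\<in>{n. even n}. upsample f n * u n)"
    by (simp add: upsample_def)
  also have "\<dots> = (\<Sum>\<^sub>\<infinity>n. upsample f n * u n)"
    by (rule infsum_cong_neutral) (auto simp: upsample_def)
  finally show ?thesis ..
qed

lemma refine_eq: "refine h f m = (\<Sum>\<^sub>\<infinity>n. f n * h (m - 2 * n))"
  unfolding refine_def conv_def by (rule infsum_upsample_mult)

lemma translate_refine: "translate (2 * k) (refine h f) = refine h (translate k f)"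
proof
  fix m
  have "bij_betw (\<lambda>n. n - k) (UNIV :: int set) UNIV"
    by (rule bij_betwI[where g = "\<lambda>n. n + k"]) auto
  from infsum_reindex_bij_betw[OF this, of "\<lambda>n. f n * h (m - 2 * k - 2 * n)"]
  show "translate (2 * k) (refine h f) m = refine h (translate k f) m"
    by (simp add: translate_def refine_eq algebra_simps)
qed

lemma upsample_conv: "upsample (conv a b) = conv (upsample a) (upsample b)"
proof
  fix k
  have "conv (upsample a) (upsample b) k = (\<Sum>\<^sub>\<infinity>n. b n * upsample a (k - 2 * n))"
    unfolding conv_def by (rule infsum_upsample_mult)
  also have "\<dots> = upsample (conv a b) k"
  proof (cases "even k")
    case True
    then obtain i where "k = 2 * i" by (elim evenE)
    moreover have "upsample a (2 * i - 2 * n) = a (i - n)" for n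
    proof -
      have "2 * i - 2 * n = 2 * (i - n)" by simp
      then show ?thesis by (simp only: upsample_def) simp
    qed
    ultimately show ?thesis by (simp add: upsample_def conv_def)
  next
    case False
    then show ?thesis by (simp add: upsample_def)
  qed
  finally show "upsample (conv a b) k = conv (upsample a) (upsample b) k" ..
qed

lemma upsample_foldr_conv:
  "upsample (foldr conv xs c) = foldr conv (map upsample xs) (upsample c)"
  by (induction xs) (simp_all add: upsample_conv)

text \<open>
  Since upsampling distributes over convolution, the outermost \<open>h\<close> of an iterated product splits
  off and leaves one upsampled product of order one less.
\<close>

lemma foldr_conv_iterated:
  "foldr conv (map (\<lambda>i. (upsample ^^ i) h) [0..<Suc n]) (upsample c)
    = refine h (foldr conv (map (\<lambda>i. (upsample ^^ i) h) [0..<n]) c)"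
proof -
  have "[0..<Suc n] = 0 # map Suc [0..<n]"
    by (simp add: map_Suc_upt upt_conv_Cons del: upt_Suc)
  then show ?thesis
    by (simp add: refine_def upsample_foldr_conv o_def del: upt_Suc)
qed

lemma upsample_delta0: "upsample delta0 = delta0"
  by (auto simp: upsample_def delta0_def fun_eq_iff)

lemma hfilt_Suc: "hfilt h (Suc j) = refine h (hfilt h j)"
  using foldr_conv_iterated[of h j delta0] by (simp add: hfilt_def upsample_delta0 del: upt_Suc)

lemma gfilt_Suc: "1 \<le> m \<Longrightarrow> gfilt h g (Suc m) = refine h (gfilt h g m)"
  using foldr_conv_iterated[of h "m - 1" "(upsample ^^ (m - 1)) g"]
  by (cases m) (simp_all add: gfilt_def del: upt_Suc)

lemma lowpass_cutoff:
  assumes "finite S"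
  shows "analysis h 1 (cutoff S x) n = (\<Sum>m\<in>S. x m * cnj (h (m - 2 * n)))"
  using assms by (simp add: analysis_eq_inner l2_inner_cutoff_left translate_def)

lemma l2_lowpass_cutoff:
  assumes "l2 h" "finite S"
  shows "l2 (analysis h 1 (cutoff S x))"
proof -
  have "l2 (\<lambda>n. cnj (h (m - 2 * n)))" for m
    using l2_subsequence[OF l2_reflected_translate[OF assms(1), of m], of "\<lambda>n. 2 * n"]
    by (simp add: inj_def)
  then have "l2 (\<lambda>n. \<Sum>m\<in>S. x m * cnj (h (m - 2 * n)))"
    by (intro l2_sum l2_cmult assms)
  moreover have "analysis h 1 (cutoff S x) = (\<lambda>n. \<Sum>m\<in>S. x m * cnj (h (m - 2 * n)))"
    using lowpass_cutoff[OF assms(2)] by blast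
  ultimately show ?thesis by simp
qed

text \<open>
  Adjointness of synthesis and low-pass analysis on sequences of finite support, where it only
  needs a finite sum to be exchanged with an infinite one.
\<close>

lemma inner_refine_cutoff:
  assumes "l2 h" "l2 f" "finite S"
  shows "l2_inner (cutoff S x) (refine h f) = l2_inner (analysis h 1 (cutoff S x)) f"
proof -
  have summ: "(\<lambda>n. x m * (cnj (h (m - 2 * n)) * cnj (f n))) summable_on UNIV" for m
  proof -
    have "l2 (\<lambda>n. cnj (h (m - 2 * n)))"
      using l2_subsequence[OF l2_reflected_translate[OF assms(1), of m], of "\<lambda>n. 2 * n"]
      by (simp add: inj_def)
    from Cauchy_Schwarz_l2(1)[OF this assms(2)] show ?thesis
      by (rule summable_on_cmult_right)
  qed
  have "l2_inner (cutoff S x) (refine h f)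
      = (\<Sum>m\<in>S. x m * (\<Sum>\<^sub>\<infinity>n. cnj (f n * h (m - 2 * n))))"
    by (simp only: l2_inner_cutoff_left[OF assms(3)] refine_eq infsum_cnj)
  also have "\<dots> = (\<Sum>m\<in>S. \<Sum>\<^sub>\<infinity>n. x m * (cnj (h (m - 2 * n)) * cnj (f n)))"
    by (simp add: infsum_cmult_right' mult.commute)
  also have "\<dots> = (\<Sum>\<^sub>\<infinity>n. \<Sum>m\<in>S. x m * (cnj (h (m - 2 * n)) * cnj (f n)))"
    using assms(3) summ by (intro infsum_of_sum[symmetric])
  also have "\<dots> = l2_inner (analysis h 1 (cutoff S x)) f"
    by (simp only: l2_inner_def lowpass_cutoff[OF assms(3)] sum_distrib_right mult.assoc)
  finally show ?thesis .
qed


section \<open>The low-pass operator is bounded\<close>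

text \<open>
  A Fatou argument. As \<open>h\<close> is square-summable, \<open>analysis h 1 (cutoff S x)\<close> converges to
  \<open>analysis h 1 x\<close> at each index when \<open>S\<close> grows. A finite partial sum of energies
  is continuous in the values it contains, so it inherits the uniform bound.
\<close>

lemma lowpass_bound_from_cutoffs:
  assumes "l2 h" "l2 x" "0 \<le> C"
    and bound: "\<And>S. finite S \<Longrightarrow> (l2_norm (analysis h 1 (cutoff S x)))\<^sup>2 \<le> C * (l2_norm (cutoff S x))\<^sup>2"
  shows "l2 (analysis h 1 x)" and "(l2_norm (analysis h 1 x))\<^sup>2 \<le> C * (l2_norm x)\<^sup>2"
proof -
  have fin: "(\<Sum>n\<in>T. (cmod (analysis h 1 x n))\<^sup>2) \<le> C * (l2_norm x)\<^sup>2" if "finite T" for T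
  proof (rule tendsto_upperbound)
    have "((\<lambda>S. analysis h 1 (cutoff S x) n) \<longlongrightarrow> analysis h 1 x n) (finite_subsets_at_top UNIV)" for n
    proof -
      have "((\<lambda>S. \<Sum>m\<in>S. x m * cnj (translate (2 * n) h m)) \<longlongrightarrow> analysis h 1 x n)
          (finite_subsets_at_top UNIV)"
        using infsum_tendsto[OF Cauchy_Schwarz_l2(1)[OF assms(2) l2_translate[OF assms(1), of "2 * n"]]]
        by (simp add: analysis_eq_inner l2_inner_def)
      then show ?thesis
        by (rule Lim_transform_eventually)
          (rule eventually_finite_subsets_at_top_weakI, simp only: lowpass_cutoff translate_def)
    qed
    then show "((\<lambda>S. \<Sum>n\<in>T. (cmod (analysis h 1 (cutoff S x) n))\<^sup>2) \<longlongrightarrow>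
        (\<Sum>n\<in>T. (cmod (analysis h 1 x n))\<^sup>2)) (finite_subsets_at_top UNIV)"
      by (intro tendsto_sum tendsto_power tendsto_norm)
    have "(\<Sum>n\<in>T. (cmod (analysis h 1 (cutoff S x) n))\<^sup>2) \<le> C * (l2_norm x)\<^sup>2" if "finite S" for S
    proof -
      have "(\<Sum>n\<in>T. (cmod (analysis h 1 (cutoff S x) n))\<^sup>2) \<le> (l2_norm (analysis h 1 (cutoff S x)))\<^sup>2"
        using l2_lowpass_cutoff[OF assms(1) that] \<open>finite T\<close> by (rule sum_power2_le_l2_norm)
      also have "\<dots> \<le> C * (\<Sum>m\<in>S. (cmod (x m))\<^sup>2)"
        using bound[OF that] l2_norm_cutoff[OF that] by simp
      also have "\<dots> \<le> C * (l2_norm x)\<^sup>2"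
        using assms(2,3) that by (intro mult_left_mono sum_power2_le_l2_norm)
      finally show ?thesis .
    qed
    then show "\<forall>\<^sub>F S in finite_subsets_at_top UNIV.
        (\<Sum>n\<in>T. (cmod (analysis h 1 (cutoff S x) n))\<^sup>2) \<le> C * (l2_norm x)\<^sup>2"
      by (rule eventually_finite_subsets_at_top_weakI)
  qed simp
  show "l2 (analysis h 1 x)" and "(l2_norm (analysis h 1 x))\<^sup>2 \<le> C * (l2_norm x)\<^sup>2"
    using l2_boundedI[OF fin] by auto
qed

definition lowpass_bounded :: "seq \<Rightarrow> real \<Rightarrow> bool" where
  "lowpass_bounded h K \<longleftrightarrow> 0 \<le> K \<and>
     (\<forall>x. l2 x \<longrightarrow> l2 (analysis h 1 x) \<and> l2_norm (analysis h 1 x) \<le> K * l2_norm x)"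

text \<open>
  Duality: the inner product of \<open>refine h f\<close> with its own cutoff \<open>z\<close> is \<open>\<parallel>z\<parallel>\<^sup>2\<close>, while adjointness on
  finite support and Cauchy-Schwarz bound it by \<open>K \<parallel>z\<parallel> \<parallel>f\<parallel>\<close>. Thus \<open>\<parallel>z\<parallel> \<le> K \<parallel>f\<parallel>\<close> for every cutoff.
\<close>

lemma l2_refine:
  assumes "l2 h" "l2 f" and K: "lowpass_bounded h K"
  shows "l2 (refine h f)"
proof (rule l2_boundedI)
  fix S :: "int set"
  assume S: "finite S"
  define z where "z = cutoff S (refine h f)"
  have sq: "(l2_norm z)\<^sup>2 = (\<Sum>m\<in>S. (cmod (refine h f m))\<^sup>2)"
    unfolding z_def by (rule l2_norm_cutoff[OF S])
  then have "l2 z"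
    unfolding z_def l2_def
    by (subst summable_on_cong_neutral[where T = S and g = "\<lambda>m. (cmod (refine h f m))\<^sup>2"])
      (auto simp: cutoff_def S)
  have "of_real ((l2_norm z)\<^sup>2) = l2_inner z (refine h f)"
    unfolding sq unfolding z_def by (simp only: of_real_sum complex_norm_square l2_inner_cutoff_left[OF S])
  also have "\<dots> = l2_inner (analysis h 1 z) f"
    unfolding z_def by (rule inner_refine_cutoff[OF assms(1,2) S])
  finally have "(l2_norm z)\<^sup>2 = cmod (l2_inner (analysis h 1 z) f)"
    by (metis norm_of_real abs_of_nonneg zero_le_power2)
  also have "\<dots> \<le> l2_norm (analysis h 1 z) * l2_norm f"
    using K \<open>l2 z\<close> assms(2) by (intro Cauchy_Schwarz_l2) (auto simp: lowpass_bounded_def)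
  also have "\<dots> \<le> (K * l2_norm z) * l2_norm f"
    using K \<open>l2 z\<close> by (intro mult_right_mono l2_norm_nonneg) (auto simp: lowpass_bounded_def)
  finally have "l2_norm z * l2_norm z \<le> (K * l2_norm f) * l2_norm z"
    by (simp add: power2_eq_square mult_ac)
  then have "l2_norm z \<le> K * l2_norm f"
    using K l2_norm_nonneg[of z] l2_norm_nonneg[of f]
    by (cases "l2_norm z = 0") (auto simp: lowpass_bounded_def)
  then show "(\<Sum>m\<in>S. (cmod (refine h f m))\<^sup>2) \<le> (K * l2_norm f)\<^sup>2"
    unfolding sq[symmetric] by (intro power_mono l2_norm_nonneg)
qed

text \<open>
  The defect \<open>d\<close> of the adjointness relation is additive and bounded in norm and vanishes on
  finite support. Hence \<open>d x\<close> equals the defect of the remainder of \<open>x\<close> outside \<open>S\<close>, which tends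
  to zero.
\<close>

lemma inner_refine:
  assumes h: "l2 h" and f: "l2 f" and x: "l2 x" and K: "lowpass_bounded h K"
  shows "l2_inner x (refine h f) = l2_inner (analysis h 1 x) f"
proof -
  have r: "l2 (refine h f)" by (rule l2_refine[OF h f K])
  define c where "c = l2_norm (refine h f) + K * l2_norm f"
  define d where "d y = l2_inner y (refine h f) - l2_inner (analysis h 1 y) f" for y
  have Hbdd: "l2 (analysis h 1 y)" "l2_norm (analysis h 1 y) \<le> K * l2_norm y" if "l2 y" for y
    using K that by (auto simp: lowpass_bounded_def)
  have d_bound: "cmod (d y) \<le> c * l2_norm y" if "l2 y" for y
  proof -
    have "cmod (d y) \<le> cmod (l2_inner y (refine h f)) + cmod (l2_inner (analysis h 1 y) f)"
      unfolding d_def by (rule norm_triangle_ineq4)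
    also have "\<dots> \<le> l2_norm y * l2_norm (refine h f) + l2_norm (analysis h 1 y) * l2_norm f"
      by (intro add_mono Cauchy_Schwarz_l2 that r f Hbdd)
    also have "\<dots> \<le> l2_norm y * l2_norm (refine h f) + (K * l2_norm y) * l2_norm f"
      by (intro add_left_mono mult_right_mono Hbdd that l2_norm_nonneg)
    finally show ?thesis by (simp add: c_def algebra_simps)
  qed
  have "cmod (d x) \<le> c * l2_norm (cutoff (- S) x)" if "finite S" for S
  proof -
    have l2s: "l2 (cutoff S x)" "l2 (cutoff (- S) x)" by (simp_all add: l2_cutoff x)
    have x_eq: "x = (\<lambda>m. cutoff S x m + cutoff (- S) x m)"
      by (simp add: cutoff_add_cutoff_Compl)
    have "l2_inner x z = l2_inner (cutoff S x) z + l2_inner (cutoff (- S) x) z" if "l2 z" for z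
      using l2_inner_add_left[OF l2s that] by (simp add: cutoff_add_cutoff_Compl)
    note inner_split = this
    have "analysis h 1 x = (\<lambda>n. analysis h 1 (cutoff S x) n + analysis h 1 (cutoff (- S) x) n)"
      by (simp add: analysis_eq_inner inner_split l2_translate h fun_eq_iff)
    then have "l2_inner (analysis h 1 x) f
        = l2_inner (analysis h 1 (cutoff S x)) f + l2_inner (analysis h 1 (cutoff (- S) x)) f"
      using l2_inner_add_left[OF Hbdd(1)[OF l2s(1)] Hbdd(1)[OF l2s(2)] f] by simp
    then have "d x = d (cutoff S x) + d (cutoff (- S) x)"
      using inner_split[OF r] by (simp add: d_def)
    also have "d (cutoff S x) = 0"
      by (simp only: d_def inner_refine_cutoff[OF h f that]) simp
    finally show ?thesis using d_bound[OF l2s(2)] by simp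
  qed
  then have "\<forall>\<^sub>F S in finite_subsets_at_top UNIV. cmod (d x) \<le> c * l2_norm (cutoff (- S) x)"
    by (rule eventually_finite_subsets_at_top_weakI)
  moreover have "((\<lambda>S. c * l2_norm (cutoff (- S) x)) \<longlongrightarrow> c * 0) (finite_subsets_at_top UNIV)"
    by (intro tendsto_mult tendsto_const cutoff_Compl_tendsto_0 x)
  ultimately have "cmod (d x) \<le> c * 0"
    by (intro tendsto_lowerbound) auto
  then show ?thesis by (simp add: d_def)
qed

text \<open>
  Analysis with the refined filter is low-pass filtering followed by analysis with the
  original one, because refinement turns a translation by \<open>k\<close> into a translation by \<open>2 * k\<close>. The
  adjointness is a hypothesis on the single sequence \<open>x\<close>, so that the lemma applies to finite
  supports before the low-pass operator is known to be bounded, and to all square-summable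
  sequences afterwards.
\<close>

lemma analysis_refine:
  assumes adj: "\<And>f. l2 f \<Longrightarrow> l2_inner x (refine h f) = l2_inner (analysis h 1 x) f" and "l2 f"
  shows "analysis (refine h f) (Suc j) x = analysis f j (analysis h 1 x)"
proof
  fix k
  have "analysis (refine h f) (Suc j) x k = l2_inner x (refine h (translate (2 ^ j * k) f))"
    by (simp only: analysis_eq_inner translate_refine[symmetric] power_Suc mult.assoc)
  also have "\<dots> = analysis f j (analysis h 1 x) k"
    unfolding analysis_eq_inner[of f] by (intro adj l2_translate assms(2))
  finally show "analysis (refine h f) (Suc j) x k = analysis f j (analysis h 1 x) k" .
qed

section \<open>Consequences of stability of the infinitely iterated filter bank\<close>

lemma inf_analysis_eq: "inf_analysis h g x j = analysis (gfilt h g j) j x"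
  by (simp add: inf_analysis_def analysis_def)

lemma fin_analysis_eq:
  "fin_analysis h g j x l
    = (if l \<le> j then inf_analysis h g x l else analysis (hfilt h j) j x)"
  by (simp add: fin_analysis_def inf_analysis_def analysis_def)

lemma analysis_delta0: "analysis delta0 0 x = x"
proof
  fix k
  have "analysis delta0 0 x k = (\<Sum>\<^sub>\<infinity>m\<in>{k}. x m * cnj (translate k delta0 m))"
    unfolding analysis_eq_inner l2_inner_def
    by (rule infsum_cong_neutral) (auto simp: translate_def delta0_def)
  then show "analysis delta0 0 x k = x k" by (simp add: translate_def delta0_def)
qed

lemma l2_delta0: "l2 delta0"
  unfolding l2_def by (rule finite_nonzero_values_imp_summable_on) (simp add: delta0_def)

text \<open>
  Downsampling by \<open>N\<close> after all shifts sees every residue class modulo \<open>N\<close>, so no information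
  about summability is lost.
\<close>

lemma l2_from_residue_classes:
  fixes N :: int
  assumes "N > 0" and l2: "\<And>s. l2 (\<lambda>k. x (s - N * k))"
  shows "l2 x"
proof -
  have "(a - N * b) mod N = a" "(a - N * b) div N = - b" if "0 \<le> a" "a < N" for a b
    using mod_mult_self2[of a N "- b"] div_mult_self2[of N a "- b"] that by simp_all
  then have "bij_betw (\<lambda>(s, k). s - N * k) ({0..<N} \<times> UNIV) UNIV"
    using assms(1)
    by (intro bij_betwI[where g = "\<lambda>n. (n mod N, - (n div N))"])
      (use assms(1) in auto)
  moreover have "(\<lambda>(s, k). (cmod (x (s - N * k)))\<^sup>2) summable_on ({0..<N} \<times> UNIV)"
    using l2 by (intro summable_on_SigmaI[where g = "\<lambda>s. \<Sum>\<^sub>\<infinity>k. (cmod (x (s - N * k)))\<^sup>2"])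
      (auto simp: l2_def intro: has_sum_infsum)
  ultimately show ?thesis
    using summable_on_reindex_bij_betw[of "\<lambda>(s, k). s - N * k" "{0..<N} \<times> UNIV" UNIV "\<lambda>m. (cmod (x m))\<^sup>2"]
    by (simp add: l2_def case_prod_unfold)
qed

text \<open>
  The response of channel \<open>j\<close> to the unit impulse at \<open>s\<close> is the conjugate of \<open>gfilt h g j\<close> on the
  residue class of \<open>s\<close> modulo \<open>2 ^ j\<close>. Stability makes these responses square-summable, which
  provides square-summability of the filters before anything is known about the low-pass branch.
\<close>

lemma l2_gfilt:
  assumes stable: "inf_stable h g A B" and "1 \<le> j"
  shows "l2 (gfilt h g j)"
proof (rule l2_from_residue_classes[where N = "2 ^ j"])
  fix s
  let ?u = "translate s delta0"
  have "l2 ?u" by (intro l2_translate l2_delta0)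
  then have "l2 (inf_analysis h g ?u j)"
    using stable assms(2) by (simp add: inf_stable_def)
  moreover have "inf_analysis h g ?u j k = cnj (gfilt h g j (s - 2 ^ j * k))" for k
  proof -
    have "inf_analysis h g ?u j k
        = (\<Sum>\<^sub>\<infinity>m\<in>{s}. ?u m * cnj (translate (2 ^ j * k) (gfilt h g j) m))"
      unfolding inf_analysis_eq analysis_eq_inner l2_inner_def
      by (rule infsum_cong_neutral) (auto simp: translate_def delta0_def)
    then show ?thesis by (simp add: translate_def delta0_def)
  qed
  ultimately show "l2 (\<lambda>k. gfilt h g j (s - 2 ^ j * k))" by (simp add: l2_def)
qed simp

lemma infsum_split_initial:
  fixes a :: "nat \<Rightarrow> real"
  assumes "a summable_on {1..}"
  shows "infsum a {1..} = (\<Sum>l = 1..J. a l) + (\<Sum>\<^sub>\<infinity>m\<in>{1..}. a (m + J))"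
proof -
  have "bij_betw (\<lambda>m. m + J) {1..} {Suc J..}"
    by (rule bij_betwI[where g = "\<lambda>m. m - J"]) auto
  from infsum_reindex_bij_betw[OF this, of a]
  have "(\<Sum>\<^sub>\<infinity>m\<in>{1..}. a (m + J)) = infsum a {Suc J..}" .
  moreover have "a summable_on {Suc J..}"
    using assms by (rule summable_on_subset_banach) auto
  moreover have "{1..} = {1..J} \<union> {Suc J..}" by auto
  moreover have "{1..J} \<inter> {Suc J..} = {}" by auto
  ultimately show ?thesis by (simp add: infsum_Un_disjoint)
qed

lemma inf_stableD:
  assumes "inf_stable h g A B" "l2 x"
  shows "1 \<le> j \<Longrightarrow> l2 (inf_analysis h g x j)"
    and "(\<lambda>j. (l2_norm (inf_analysis h g x j))\<^sup>2) summable_on {1..}"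
    and "A * (l2_norm x)\<^sup>2 \<le> (\<Sum>\<^sub>\<infinity>j\<in>{1..}. (l2_norm (inf_analysis h g x j))\<^sup>2)"
    and "(\<Sum>\<^sub>\<infinity>j\<in>{1..}. (l2_norm (inf_analysis h g x j))\<^sup>2) \<le> B * (l2_norm x)\<^sup>2"
  using assms by (auto simp: inf_stable_def)

lemma inf_analysis_add_1:
  assumes "inf_stable h g A B" "1 \<le> m"
    and "\<And>f. l2 f \<Longrightarrow> l2_inner x (refine h f) = l2_inner (analysis h 1 x) f"
  shows "inf_analysis h g x (Suc m) = inf_analysis h g (analysis h 1 x) m"
  unfolding inf_analysis_eq gfilt_Suc[OF assms(2)]
  by (rule analysis_refine[OF assms(3) l2_gfilt[OF assms(1,2)]])

text \<open>
  For \<open>x\<close> of finite support, the infinite filter bank applied to \<open>H x\<close> is the analysis of \<open>x\<close> with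
  its first channel removed. The lower bound at \<open>H x\<close> and the upper bound at \<open>x\<close> combine to
  \<open>A \<parallel>H x\<parallel>\<^sup>2 \<le> B \<parallel>x\<parallel>\<^sup>2\<close>.
\<close>

lemma lowpass_bounded_of_inf_stable:
  assumes h: "l2 h" and stable: "inf_stable h g A B"
  shows "lowpass_bounded h (sqrt (B / A))"
proof -
  have AB: "0 < A" "A \<le> B" using stable by (auto simp: inf_stable_def)
  have fin: "(l2_norm (analysis h 1 (cutoff S x)))\<^sup>2 \<le> B / A * (l2_norm (cutoff S x))\<^sup>2"
    if x: "l2 x" and S: "finite S" for x S
  proof -
    let ?y = "analysis h 1 (cutoff S x)" and ?x = "cutoff S x"
    let ?a = "\<lambda>j. (l2_norm (inf_analysis h g ?x j))\<^sup>2"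
    have l2x: "l2 ?x" by (rule l2_cutoff[OF x])
    have "inf_analysis h g ?x (m + 1) = inf_analysis h g ?y m" if "1 \<le> m" for m
      using inf_analysis_add_1[OF stable that] inner_refine_cutoff[OF h _ S] by simp
    then have "(\<Sum>\<^sub>\<infinity>m\<in>{1..}. (l2_norm (inf_analysis h g ?y m))\<^sup>2) = (\<Sum>\<^sub>\<infinity>m\<in>{1..}. ?a (m + 1))"
      by (intro infsum_cong) (simp del: One_nat_def)
    then have "A * (l2_norm ?y)\<^sup>2 \<le> (\<Sum>\<^sub>\<infinity>m\<in>{1..}. ?a (m + 1))"
      using inf_stableD(3)[OF stable l2_lowpass_cutoff[OF h S]] by metis
    also have "\<dots> \<le> infsum ?a {1..}"
      using infsum_split_initial[OF inf_stableD(2)[OF stable l2x], of 1] by simp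
    also have "\<dots> \<le> B * (l2_norm ?x)\<^sup>2"
      by (rule inf_stableD(4)[OF stable l2x])
    finally show ?thesis using AB(1) by (simp add: field_simps)
  qed
  have "l2_norm (analysis h 1 x) \<le> sqrt (B / A) * l2_norm x" if "l2 x" for x
  proof -
    have "l2_norm (analysis h 1 x) \<le> sqrt (B / A * (l2_norm x)\<^sup>2)"
      using lowpass_bound_from_cutoffs(2)[OF h that _ fin[OF that]] AB by (intro real_le_rsqrt) auto
    also have "\<dots> = sqrt (B / A) * l2_norm x"
      unfolding real_sqrt_mult by (simp add: l2_norm_nonneg)
    finally show ?thesis .
  qed
  moreover have "l2 (analysis h 1 x)" if "l2 x" for x
    using lowpass_bound_from_cutoffs(1)[OF h that _ fin[OF that]] AB by auto
  ultimately show ?thesis using AB by (simp add: lowpass_bounded_def)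
qed

text \<open>
  Induction on \<open>j\<close> with \<open>x\<close> arbitrary: the outermost refinement step of \<open>hfilt h (Suc j)\<close> and of
  the \<open>gfilt\<close> family is moved onto \<open>x\<close>, and the hypothesis is used at \<open>analysis h 1 x\<close>.
  Square-summability of \<open>hfilt h j\<close> is carried along because the adjointness requires it.
\<close>

lemma iterated_lowpass:
  assumes h: "l2 h" and stable: "inf_stable h g A B" and x: "l2 x"
  shows "l2 (hfilt h j) \<and> l2 (analysis (hfilt h j) j x) \<and>
    (\<forall>m\<ge>1. inf_analysis h g x (m + j) = inf_analysis h g (analysis (hfilt h j) j x) m)"
  using x
proof (induction j arbitrary: x)
  case 0
  then show ?case by (simp add: hfilt_def analysis_delta0 l2_delta0)
next
  case (Suc j)
  note bdd = lowpass_bounded_of_inf_stable[OF h stable]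
  let ?y = "analysis h 1 x"
  have y: "l2 ?y" using bdd Suc.prems by (simp add: lowpass_bounded_def)
  note IH = Suc.IH[OF y]
  note adj = inner_refine[OF h _ Suc.prems bdd]
  have "analysis (hfilt h (Suc j)) (Suc j) x = analysis (hfilt h j) j ?y"
    unfolding hfilt_Suc using IH by (intro analysis_refine adj) auto
  moreover have "l2 (hfilt h (Suc j))"
    unfolding hfilt_Suc using IH bdd h by (intro l2_refine) auto
  moreover have "inf_analysis h g x (m + Suc j) = inf_analysis h g ?y (m + j)" if "1 \<le> m" for m
    using inf_analysis_add_1[OF stable, of "m + j" x] adj that by simp
  ultimately show ?case using IH by simp
qed

theorem theorem3p2:
  fixes h g :: "int \<Rightarrow> complex" and A B :: real
  assumes "l2 h" and "l2 g"
    and "inf_stable h g A B"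
  shows "\<forall>j\<ge>1. fin_stable h g j (min A (A / B)) (max B (B / A))"
proof (intro allI impI)
  fix j :: nat
  assume "1 \<le> j"
  note stable = assms(3)
  have AB: "0 < A" "A \<le> B" using stable by (auto simp: inf_stable_def)
  have "(\<forall>l\<in>{1..j + 1}. l2 (fin_analysis h g j x l)) \<and>
      min A (A / B) * (l2_norm x)\<^sup>2 \<le> (\<Sum>l = 1..j + 1. (l2_norm (fin_analysis h g j x l))\<^sup>2) \<and>
      (\<Sum>l = 1..j + 1. (l2_norm (fin_analysis h g j x l))\<^sup>2) \<le> max B (B / A) * (l2_norm x)\<^sup>2"
    if x: "l2 x" for x
  proof -
    let ?a = "\<lambda>l. (l2_norm (inf_analysis h g x l))\<^sup>2"
    define y where "y = analysis (hfilt h j) j x"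
    define s where "s = (\<Sum>l = 1..j. ?a l)"
    define t where "t = (\<Sum>\<^sub>\<infinity>m\<in>{1..}. ?a (m + j))"
    define n where "n = (l2_norm y)\<^sup>2"
    define N where "N = (l2_norm x)\<^sup>2"
    have y: "l2 y" and shift: "\<And>m. 1 \<le> m \<Longrightarrow> inf_analysis h g x (m + j) = inf_analysis h g y m"
      unfolding y_def using iterated_lowpass[OF assms(1) stable x, of j] by auto
    have t_eq: "t = (\<Sum>\<^sub>\<infinity>m\<in>{1..}. (l2_norm (inf_analysis h g y m))\<^sup>2)"
      unfolding t_def by (intro infsum_cong) (simp add: shift)
    have t: "A * n \<le> t" "t \<le> B * n"
      unfolding t_eq n_def by (rule inf_stableD[OF stable y])+
    have "infsum ?a {1..} = s + t"
      unfolding s_def t_def by (rule infsum_split_initial[OF inf_stableD(2)[OF stable x]])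
    then have st: "A * N \<le> s + t" "s + t \<le> B * N"
      unfolding N_def using inf_stableD(3,4)[OF stable x] by auto
    have s0: "0 \<le> s" unfolding s_def by (simp add: sum_nonneg)
    have n0: "0 \<le> n" "0 \<le> N" by (simp_all add: n_def N_def)
    have sum_eq: "(\<Sum>l = 1..j + 1. (l2_norm (fin_analysis h g j x l))\<^sup>2) = s + n"
      by (simp add: fin_analysis_eq s_def n_def y_def)
    \<comment> \<open>Replacing \<open>t\<close> by \<open>n\<close> scales one summand of \<open>s + t\<close>; the case distinction decides
        whether the scaling factor or the factor 1 of \<open>s\<close> is the worse one.\<close>
    have "min A (A / B) * N \<le> s + n"
    proof (cases "B \<le> 1")
      case True
      then have "A * N \<le> s + n"
        using st(1) t(2) mult_right_mono[OF True n0(1)] by linarith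
      moreover have "min A (A / B) * N \<le> A * N"
        using n0 by (intro mult_right_mono) auto
      ultimately show ?thesis by linarith
    next
      case False
      then have "A * N \<le> B * (s + n)"
        using st(1) t(2) mult_right_mono[of 1 B s] s0 by (simp add: distrib_left)
      then have "A / B * N \<le> s + n"
        using AB by (simp add: field_simps)
      moreover have "min A (A / B) * N \<le> A / B * N"
        using n0 by (intro mult_right_mono) auto
      ultimately show ?thesis by linarith
    qed
    moreover have "s + n \<le> max B (B / A) * N"
    proof (cases "A \<ge> 1")
      case True
      then have "s + n \<le> B * N"
        using st(2) t(1) mult_right_mono[OF True n0(1)] by linarith
      moreover have "B * N \<le> max B (B / A) * N"
        using n0 by (intro mult_right_mono) auto
      ultimately show ?thesis by linarith
    next
      case False
      then have "A * (s + n) \<le> B * N"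
        using st(2) t(1) mult_right_mono[of A 1 s] s0 by (simp add: distrib_left)
      then have "s + n \<le> B / A * N"
        using AB by (simp add: field_simps)
      moreover have "B / A * N \<le> max B (B / A) * N"
        using n0 by (intro mult_right_mono) auto
      ultimately show ?thesis by linarith
    qed
    moreover have "l2 (fin_analysis h g j x l)" if "l \<in> {1..j + 1}" for l
      using that y inf_stableD(1)[OF stable x] by (auto simp: fin_analysis_eq y_def)
    ultimately show ?thesis unfolding sum_eq N_def by blast
  qed
  moreover have "0 < min A (A / B)" "min A (A / B) \<le> max B (B / A)"
    using AB by auto
  ultimately show "fin_stable h g j (min A (A / B)) (max B (B / A))"
    by (simp add: fin_stable_def)
qed

end
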